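(* Let $p_X, p_Y \in [0,1]$ and let $\delta \ge 0$ be an integer. Let $(X_i)_{i\ge 1}$ and $(Y_j)_{j \ge 1}$ be two independent sequences of random variables, where the $X_i$ are i.i.d. Bernoulli($p_X$) and the $Y_j$ are i.i.d. Bernoulli($p_Y$). For $i \ge \delta+1$ let $$W_i = X_i \sum_{j=-\delta}^{\delta} Y_{i+j}, \qquad Z_i = W_i - \mathbb{E}(W_i),$$ and, for any integer $\ell \ge \delta+1$ (the value does not depend on $\ell$), define $$\sigma_\delta^2 = \mathbb{E}(Z_\ell^2) + 2\sum_{k=1}^{2\delta+1} \mathbb{E}(Z_\ell Z_{\ell+k}) = \mathrm{Var}(W_\ell) + 2\sum_{k=1}^{2\delta+1} \mathrm{Cov}(W_\ell, W_{\ell+k}).$$ Then $$\sigma_\delta^2 = (2\delta+1)\,p_X p_Y (1 - p_X p_Y) + 2\delta(2\delta+1)\, p_X p_Y \big( p_Y(1-p_X) + p_X(1-p_Y)\big).$$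
   Context: Bernoulli($p$) random variables take value $1$ with probability $p$ and $0$ with probability $1-p$. *)

theory Defs
  imports "HOL-Probability.Probability"
begin

text \<open>Real-valued random variable with the law of the library's boolean Bernoulli distribution
  under \<open>True \<mapsto> 1, False \<mapsto> 0\<close>.  \<open>bernoulli_pmf p\<close> clamps \<open>p\<close> to the unit interval, so
  \<open>p \<in> {0..1}\<close> has to be assumed separately where this is used.\<close>

definition bernoulli_rv :: "'a measure \<Rightarrow> ('a \<Rightarrow> real) \<Rightarrow> real \<Rightarrow> bool" where
  "bernoulli_rv M X p \<longleftrightarrow>
     X \<in> borel_measurable M \<and>
     distr M borel X = distr (measure_pmf (bernoulli_pmf p)) borel (of_bool :: bool \<Rightarrow> real)"

definition iid_bernoulli :: "'a measure \<Rightarrow> (nat \<Rightarrow> 'a \<Rightarrow> real) \<Rightarrow> real \<Rightarrow> bool" where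
  "iid_bernoulli M X p \<longleftrightarrow>
     prob_space.indep_vars M (\<lambda>_. borel) X {1..} \<and> (\<forall>i\<ge>1. bernoulli_rv M (X i) p)"

text \<open>Independence of the two whole sequences, seen as random elements of the product space
  over the index set \<open>{1..}\<close>.\<close>

definition indep_sequences ::
    "'a measure \<Rightarrow> (nat \<Rightarrow> 'a \<Rightarrow> real) \<Rightarrow> (nat \<Rightarrow> 'a \<Rightarrow> real) \<Rightarrow> bool" where
  "indep_sequences M X Y \<longleftrightarrow>
     prob_space.indep_var M
       (PiM {1..} (\<lambda>_. borel)) (\<lambda>\<omega>. \<lambda>i\<in>{1..}. X i \<omega>)
       (PiM {1..} (\<lambda>_. borel)) (\<lambda>\<omega>. \<lambda>j\<in>{1..}. Y j \<omega>)"

definition covariance :: "'a measure \<Rightarrow> ('a \<Rightarrow> real) \<Rightarrow> ('a \<Rightarrow> real) \<Rightarrow> real" where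
  "covariance M U V =
     prob_space.expectation M
       (\<lambda>\<omega>. (U \<omega> - prob_space.expectation M U) * (V \<omega> - prob_space.expectation M V))"

text \<open>Meaningful for \<open>i \<ge> \<delta> + 1\<close> only: then \<open>int i + j \<ge> 1\<close> throughout, so \<open>nat\<close> does not
  truncate and only members of the sequence \<open>Y\<^sub>1, Y\<^sub>2, \<dots>\<close> occur.\<close>

definition window_W ::
    "nat \<Rightarrow> (nat \<Rightarrow> 'a \<Rightarrow> real) \<Rightarrow> (nat \<Rightarrow> 'a \<Rightarrow> real) \<Rightarrow> nat \<Rightarrow> 'a \<Rightarrow> real" where
  "window_W \<delta> X Y i \<omega> = X i \<omega> * (\<Sum>j\<in>{- int \<delta>..int \<delta>}. Y (nat (int i + j)) \<omega>)"

definition window_Z ::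
    "'a measure \<Rightarrow> nat \<Rightarrow> (nat \<Rightarrow> 'a \<Rightarrow> real) \<Rightarrow> (nat \<Rightarrow> 'a \<Rightarrow> real) \<Rightarrow> nat \<Rightarrow> 'a \<Rightarrow> real" where
  "window_Z M \<delta> X Y i \<omega> =
     window_W \<delta> X Y i \<omega> - prob_space.expectation M (window_W \<delta> X Y i)"

definition sigma_sq ::
    "'a measure \<Rightarrow> nat \<Rightarrow> (nat \<Rightarrow> 'a \<Rightarrow> real) \<Rightarrow> (nat \<Rightarrow> 'a \<Rightarrow> real) \<Rightarrow> nat \<Rightarrow> real" where
  "sigma_sq M \<delta> X Y l =
     prob_space.expectation M (\<lambda>\<omega>. (window_Z M \<delta> X Y l \<omega>)\<^sup>2) +
     2 * (\<Sum>k=1..2*\<delta>+1.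
            prob_space.expectation M (\<lambda>\<omega>. window_Z M \<delta> X Y l \<omega> * window_Z M \<delta> X Y (l + k) \<omega>))"

end

theory Submission
  imports Defs
begin

text \<open>
  Write \<open>W\<^sub>i = X\<^sub>i S\<^sub>i\<close>, where \<open>S\<^sub>i\<close> is the sum of \<open>Y\<close> over the window \<open>I\<^sub>i = {i-\<delta>..i+\<delta>}\<close> of
  \<open>n = 2\<delta>+1\<close> indices.  Everything reduces to the mixed second moments \<open>E(W\<^sub>i W\<^sub>j)\<close>.  As the
  two sequences are independent, these factor as \<open>E(X\<^sub>i X\<^sub>j) E(S\<^sub>i S\<^sub>j)\<close>.  A Bernoulli variable
  is idempotent, so \<open>E(Y\<^sub>a Y\<^sub>b)\<close> is \<open>p\<^sub>Y\<close> on the diagonal and \<open>p\<^sub>Y\<^sup>2\<close> off it; summing over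
  \<open>I\<^sub>i \<times> I\<^sub>j\<close> gives
  \[ E(S_i S_j) = n^2 p_Y^2 + |I_i \cap I_j| \, p_Y (1 - p_Y), \]
  because the diagonal terms are indexed by \<open>I\<^sub>i \<inter> I\<^sub>j\<close> (lemma \<open>expectation_sum_mult_sum\<close>).

  Windows at distance \<open>k\<close> share \<open>n - k\<close> indices when \<open>k \<le> n\<close>.  Hence, for \<open>1 \<le> k \<le> n\<close>,
  \<open>Cov(W\<^sub>l, W\<^sub>l\<^sub>+\<^sub>k) = p\<^sub>X\<^sup>2 p\<^sub>Y (1 - p\<^sub>Y) (n - k)\<close>: the products of means cancel.  Twice the sum of
  these over \<open>k\<close> is \<open>n (n-1) p\<^sub>X\<^sup>2 p\<^sub>Y (1 - p\<^sub>Y)\<close>.  At \<open>k = 0\<close>, where the first factor is \<open>p\<^sub>X\<close>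
  instead of \<open>p\<^sub>X\<^sup>2\<close>, one gets the variance
  \<open>p\<^sub>X (n\<^sup>2 p\<^sub>Y\<^sup>2 + n p\<^sub>Y (1 - p\<^sub>Y)) - n\<^sup>2 p\<^sub>X\<^sup>2 p\<^sub>Y\<^sup>2\<close>, and the two add up to the claim.
\<close>

section \<open>Moments of Bernoulli sequences\<close>

lemma bernoulli_rv_transfer:
  fixes f :: "real \<Rightarrow> real"
  assumes X: "bernoulli_rv M X p" and p: "p \<in> {0..1}" and f: "f \<in> borel_measurable borel"
  shows "integrable M (\<lambda>\<omega>. f (X \<omega>))"
    and "(\<integral>\<omega>. f (X \<omega>) \<partial>M) = p * f 1 + (1 - p) * f 0"
proof -
  have XM: "X \<in> borel_measurable M"
    and D: "distr M borel X = distr (measure_pmf (bernoulli_pmf p)) borel (of_bool :: bool \<Rightarrow> real)"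
    using X by (auto simp: bernoulli_rv_def)
  have "integrable (distr M borel X) f"
    unfolding D using f
    by (subst integrable_distr_eq) (auto intro: integrable_measure_pmf_finite)
  then show "integrable M (\<lambda>\<omega>. f (X \<omega>))"
    using XM f by (simp add: integrable_distr_eq)
  have "(\<integral>\<omega>. f (X \<omega>) \<partial>M) = integral\<^sup>L (distr M borel X) f"
    using XM f by (simp add: integral_distr)
  also have "\<dots> = (\<integral>b. f (of_bool b) \<partial>measure_pmf (bernoulli_pmf p))"
    unfolding D using f by (subst integral_distr) auto
  also have "\<dots> = p * f 1 + (1 - p) * f 0"
    using p by simp
  finally show "(\<integral>\<omega>. f (X \<omega>) \<partial>M) = p * f 1 + (1 - p) * f 0" .
qed

lemma iid_bernoulli_first_moment:
  assumes "iid_bernoulli M X p" "p \<in> {0..1}" "i \<ge> 1"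
  shows "integrable M (X i)" and "integral\<^sup>L M (X i) = p"
  using assms bernoulli_rv_transfer[of M "X i" p "\<lambda>x. x"]
  by (auto simp: iid_bernoulli_def)

text \<open>The diagonal value is \<open>p\<close> rather than \<open>p\<^sup>2\<close> because \<open>x\<^sup>2 = x\<close> on \<open>{0, 1}\<close>.\<close>

lemma iid_bernoulli_second_moment:
  assumes M: "prob_space M" and X: "iid_bernoulli M X p" and p: "p \<in> {0..1}"
    and ij: "i \<ge> 1" "j \<ge> 1"
  shows "integrable M (\<lambda>\<omega>. X i \<omega> * X j \<omega>)"
    and "(\<integral>\<omega>. X i \<omega> * X j \<omega> \<partial>M) = (if i = j then p else p\<^sup>2)"
proof -
  interpret prob_space M by (rule M)
  have "integrable M (\<lambda>\<omega>. X i \<omega> * X j \<omega>) \<and>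
    (\<integral>\<omega>. X i \<omega> * X j \<omega> \<partial>M) = (if i = j then p else p\<^sup>2)"
  proof (cases "i = j")
    case True
    have "bernoulli_rv M (X i) p" using X ij by (simp add: iid_bernoulli_def)
    then show ?thesis
      using bernoulli_rv_transfer[of M "X i" p "\<lambda>x. x * x"] p True by simp
  next
    case False
    have I: "indep_vars (\<lambda>_. borel) X {i, j}"
      using X ij by (auto simp: iid_bernoulli_def intro: indep_vars_subset)
    have int: "integrable M (X k)" if "k \<in> {i, j}" for k
      using iid_bernoulli_first_moment(1)[OF X p, of k] ij that by auto
    have "integrable M (\<lambda>\<omega>. \<Prod>k\<in>{i, j}. X k \<omega>)"
      by (rule indep_vars_integrable[OF _ I int]) auto
    moreover have "(\<integral>\<omega>. (\<Prod>k\<in>{i, j}. X k \<omega>) \<partial>M) = (\<Prod>k\<in>{i, j}. integral\<^sup>L M (X k))"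
      by (rule indep_vars_lebesgue_integral[OF _ I int]) auto
    ultimately show ?thesis
      using False iid_bernoulli_first_moment(2)[OF X p] ij by (simp add: power2_eq_square)
  qed
  then show "integrable M (\<lambda>\<omega>. X i \<omega> * X j \<omega>)"
    and "(\<integral>\<omega>. X i \<omega> * X j \<omega> \<partial>M) = (if i = j then p else p\<^sup>2)" by auto
qed

text \<open>Each of the \<open>card A * card B\<close> pairs contributes \<open>p\<^sup>2\<close>, and each pair on the diagonal a
  further \<open>p - p\<^sup>2\<close>.\<close>

lemma expectation_sum_mult_sum:
  assumes M: "prob_space M" and Y: "iid_bernoulli M Y p" and p: "p \<in> {0..1}"
    and AB: "finite A" "finite B" "A \<subseteq> {1..}" "B \<subseteq> {1..}"
  shows "integrable M (\<lambda>\<omega>. (\<Sum>a\<in>A. Y a \<omega>) * (\<Sum>b\<in>B. Y b \<omega>))"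
    and "(\<integral>\<omega>. (\<Sum>a\<in>A. Y a \<omega>) * (\<Sum>b\<in>B. Y b \<omega>) \<partial>M) =
           real (card A) * real (card B) * p\<^sup>2 + real (card (A \<inter> B)) * (p * (1 - p))"
proof -
  have int: "integrable M (\<lambda>\<omega>. Y a \<omega> * Y b \<omega>)" if "a \<in> A" "b \<in> B" for a b
    using iid_bernoulli_second_moment(1)[OF M Y p, of a b] that AB by auto
  have expand: "(\<lambda>\<omega>. (\<Sum>a\<in>A. Y a \<omega>) * (\<Sum>b\<in>B. Y b \<omega>)) =
      (\<lambda>\<omega>. \<Sum>a\<in>A. \<Sum>b\<in>B. Y a \<omega> * Y b \<omega>)"
    by (simp add: sum_product)
  show "integrable M (\<lambda>\<omega>. (\<Sum>a\<in>A. Y a \<omega>) * (\<Sum>b\<in>B. Y b \<omega>))"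
    unfolding expand by (intro Bochner_Integration.integrable_sum int)
  have "(\<integral>\<omega>. (\<Sum>a\<in>A. Y a \<omega>) * (\<Sum>b\<in>B. Y b \<omega>) \<partial>M) =
      (\<Sum>a\<in>A. \<integral>\<omega>. (\<Sum>b\<in>B. Y a \<omega> * Y b \<omega>) \<partial>M)"
    unfolding expand
    by (rule Bochner_Integration.integral_sum, intro Bochner_Integration.integrable_sum int)
  also have "\<dots> = (\<Sum>a\<in>A. \<Sum>b\<in>B. \<integral>\<omega>. Y a \<omega> * Y b \<omega> \<partial>M)"
    by (intro sum.cong refl Bochner_Integration.integral_sum int)
  also have "\<dots> = (\<Sum>a\<in>A. \<Sum>b\<in>B. p\<^sup>2 + (if a = b then p * (1 - p) else 0))"
  proof (intro sum.cong refl)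
    fix a b assume "a \<in> A" "b \<in> B"
    then have "a \<ge> 1" "b \<ge> 1" using AB by auto
    then show "(\<integral>\<omega>. Y a \<omega> * Y b \<omega> \<partial>M) = p\<^sup>2 + (if a = b then p * (1 - p) else 0)"
      using iid_bernoulli_second_moment(2)[OF M Y p, of a b]
      by (auto simp: power2_eq_square algebra_simps)
  qed
  also have "\<dots> = real (card A) * real (card B) * p\<^sup>2 + (\<Sum>a\<in>A. if a \<in> B then p * (1 - p) else 0)"
    using AB by (simp add: sum.distrib)
  also have "(\<Sum>a\<in>A. if a \<in> B then p * (1 - p) else 0) = real (card (A \<inter> B)) * (p * (1 - p))"
    using AB by (simp flip: sum.inter_restrict)
  finally show "(\<integral>\<omega>. (\<Sum>a\<in>A. Y a \<omega>) * (\<Sum>b\<in>B. Y b \<omega>) \<partial>M) =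
      real (card A) * real (card B) * p\<^sup>2 + real (card (A \<inter> B)) * (p * (1 - p))" .
qed

section \<open>Factorization across the two sequences\<close>

lemma indep_sequences_imp_indep_var:
  fixes f g :: "(nat \<Rightarrow> real) \<Rightarrow> real"
  assumes M: "prob_space M" and I: "indep_sequences M X Y"
    and "f \<in> borel_measurable (PiM {1..} (\<lambda>_. borel))"
    and "g \<in> borel_measurable (PiM {1..} (\<lambda>_. borel))"
  shows "prob_space.indep_var M borel (\<lambda>\<omega>. f (\<lambda>i\<in>{1..}. X i \<omega>)) borel (\<lambda>\<omega>. g (\<lambda>i\<in>{1..}. Y i \<omega>))"
  using prob_space.indep_var_compose[OF M I[unfolded indep_sequences_def] assms(3,4)]
  by (simp add: comp_def)

text \<open>Grouping the four factors as \<open>X\<^sub>i X\<^sub>j\<close> and \<open>(\<Sum>a\<in>A. Y\<^sub>a) (\<Sum>b\<in>B. Y\<^sub>b)\<close> makes each group a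
  functional of one sequence, so the expectation factors even when \<open>i = j\<close> or \<open>A\<close> and \<open>B\<close> overlap.\<close>

lemma expectation_product_of_weighted_sums:
  assumes M: "prob_space M" and X: "iid_bernoulli M X p" and p: "p \<in> {0..1}"
    and Y: "iid_bernoulli M Y q" and q: "q \<in> {0..1}" and XY: "indep_sequences M X Y"
    and ij: "i \<ge> 1" "j \<ge> 1"
    and AB: "finite A" "finite B" "A \<subseteq> {1..}" "B \<subseteq> {1..}"
  shows "integrable M (\<lambda>\<omega>. (X i \<omega> * (\<Sum>a\<in>A. Y a \<omega>)) * (X j \<omega> * (\<Sum>b\<in>B. Y b \<omega>)))"
    and "(\<integral>\<omega>. (X i \<omega> * (\<Sum>a\<in>A. Y a \<omega>)) * (X j \<omega> * (\<Sum>b\<in>B. Y b \<omega>)) \<partial>M) =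
      (if i = j then p else p\<^sup>2) *
      (real (card A) * real (card B) * q\<^sup>2 + real (card (A \<inter> B)) * (q * (1 - q)))"
proof -
  interpret prob_space M by (rule M)
  define f where "f = (\<lambda>x::nat \<Rightarrow> real. x i * x j)"
  define g where "g = (\<lambda>y::nat \<Rightarrow> real. (\<Sum>a\<in>A. y a) * (\<Sum>b\<in>B. y b))"
  have fm: "f \<in> borel_measurable (PiM {1..} (\<lambda>_. borel))"
    unfolding f_def using ij
    by (intro borel_measurable_times measurable_component_singleton) auto
  have gm: "g \<in> borel_measurable (PiM {1..} (\<lambda>_. borel))"
    unfolding g_def using AB
    by (intro borel_measurable_times borel_measurable_sum measurable_component_singleton) auto
  have fX: "f (\<lambda>i\<in>{1..}. X i \<omega>) = X i \<omega> * X j \<omega>" for \<omega>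
    using ij by (simp add: f_def)
  have gY: "g (\<lambda>i\<in>{1..}. Y i \<omega>) = (\<Sum>a\<in>A. Y a \<omega>) * (\<Sum>b\<in>B. Y b \<omega>)" for \<omega>
    unfolding g_def using AB by (intro arg_cong2[where f="(*)"] sum.cong) auto
  have ind: "indep_var borel (\<lambda>\<omega>. X i \<omega> * X j \<omega>) borel
      (\<lambda>\<omega>. (\<Sum>a\<in>A. Y a \<omega>) * (\<Sum>b\<in>B. Y b \<omega>))"
    using indep_sequences_imp_indep_var[OF M XY fm gm] unfolding fX gY .
  have regroup: "(\<lambda>\<omega>. (X i \<omega> * (\<Sum>a\<in>A. Y a \<omega>)) * (X j \<omega> * (\<Sum>b\<in>B. Y b \<omega>))) =
      (\<lambda>\<omega>. (X i \<omega> * X j \<omega>) * ((\<Sum>a\<in>A. Y a \<omega>) * (\<Sum>b\<in>B. Y b \<omega>)))"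
    by (simp add: mult_ac)
  note XX = iid_bernoulli_second_moment[OF M X p ij]
    and SS = expectation_sum_mult_sum[OF M Y q AB]
  show "integrable M (\<lambda>\<omega>. (X i \<omega> * (\<Sum>a\<in>A. Y a \<omega>)) * (X j \<omega> * (\<Sum>b\<in>B. Y b \<omega>)))"
    unfolding regroup by (rule indep_var_integrable[OF ind XX(1) SS(1)])
  show "(\<integral>\<omega>. (X i \<omega> * (\<Sum>a\<in>A. Y a \<omega>)) * (X j \<omega> * (\<Sum>b\<in>B. Y b \<omega>)) \<partial>M) =
      (if i = j then p else p\<^sup>2) *
      (real (card A) * real (card B) * q\<^sup>2 + real (card (A \<inter> B)) * (q * (1 - q)))"
    unfolding regroup indep_var_lebesgue_integral[OF ind XX(1) SS(1)] XX(2) SS(2) ..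
qed

lemma expectation_weighted_sum:
  assumes M: "prob_space M" and X: "iid_bernoulli M X p" and p: "p \<in> {0..1}"
    and Y: "iid_bernoulli M Y q" and q: "q \<in> {0..1}" and XY: "indep_sequences M X Y"
    and i: "i \<ge> 1" and A: "finite A" "A \<subseteq> {1..}"
  shows "integrable M (\<lambda>\<omega>. X i \<omega> * (\<Sum>a\<in>A. Y a \<omega>))"
    and "(\<integral>\<omega>. X i \<omega> * (\<Sum>a\<in>A. Y a \<omega>) \<partial>M) = p * (real (card A) * q)"
proof -
  interpret prob_space M by (rule M)
  define f where "f = (\<lambda>x::nat \<Rightarrow> real. x i)"
  define g where "g = (\<lambda>y::nat \<Rightarrow> real. \<Sum>a\<in>A. y a)"
  have fm: "f \<in> borel_measurable (PiM {1..} (\<lambda>_. borel))"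
    unfolding f_def using i by (intro measurable_component_singleton) auto
  have gm: "g \<in> borel_measurable (PiM {1..} (\<lambda>_. borel))"
    unfolding g_def using A
    by (intro borel_measurable_sum measurable_component_singleton) auto
  have fX: "f (\<lambda>i\<in>{1..}. X i \<omega>) = X i \<omega>" for \<omega>
    using i by (simp add: f_def)
  have gY: "g (\<lambda>i\<in>{1..}. Y i \<omega>) = (\<Sum>a\<in>A. Y a \<omega>)" for \<omega>
    unfolding g_def using A by (intro sum.cong) auto
  have ind: "indep_var borel (X i) borel (\<lambda>\<omega>. \<Sum>a\<in>A. Y a \<omega>)"
    using indep_sequences_imp_indep_var[OF M XY fm gm] unfolding fX gY .
  note X1 = iid_bernoulli_first_moment[OF X p i]
  have Y1: "integrable M (Y a)" "integral\<^sup>L M (Y a) = q" if "a \<in> A" for a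
    using iid_bernoulli_first_moment[OF Y q, of a] A that by auto
  have S1: "integrable M (\<lambda>\<omega>. \<Sum>a\<in>A. Y a \<omega>)"
    by (intro Bochner_Integration.integrable_sum Y1)
  have S2: "(\<integral>\<omega>. (\<Sum>a\<in>A. Y a \<omega>) \<partial>M) = real (card A) * q"
    by (subst Bochner_Integration.integral_sum) (simp_all add: Y1)
  show "integrable M (\<lambda>\<omega>. X i \<omega> * (\<Sum>a\<in>A. Y a \<omega>))"
    by (rule indep_var_integrable[OF ind X1(1) S1])
  show "(\<integral>\<omega>. X i \<omega> * (\<Sum>a\<in>A. Y a \<omega>) \<partial>M) = p * (real (card A) * q)"
    unfolding indep_var_lebesgue_integral[OF ind X1(1) S1] X1(2) S2 ..
qed

section \<open>Covariances of the window sums\<close>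

lemma window_W_eq_sum_interval:
  assumes "\<delta> \<le> i"
  shows "window_W \<delta> X Y i = (\<lambda>\<omega>. X i \<omega> * (\<Sum>a\<in>{i - \<delta>..i + \<delta>}. Y a \<omega>))"
proof
  fix \<omega>
  have "(\<Sum>j\<in>{- int \<delta>..int \<delta>}. Y (nat (int i + j)) \<omega>) = (\<Sum>a\<in>{i - \<delta>..i + \<delta>}. Y a \<omega>)"
    using assms
    by (intro sum.reindex_bij_witness[of _ "\<lambda>a. int a - int i" "\<lambda>j. nat (int i + j)"]) auto
  then show "window_W \<delta> X Y i \<omega> = X i \<omega> * (\<Sum>a\<in>{i - \<delta>..i + \<delta>}. Y a \<omega>)"
    by (simp add: window_W_def)
qed

text \<open>The truncated subtraction \<open>2 * \<delta> + 1 - k\<close> is the number of indices shared by two windows at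
  distance \<open>k\<close>, for every \<open>k\<close>: it vanishes when the windows are disjoint.\<close>

lemma expectation_window_Z_mult:
  assumes M: "prob_space M" and X: "iid_bernoulli M X p" and p: "p \<in> {0..1}"
    and Y: "iid_bernoulli M Y q" and q: "q \<in> {0..1}" and XY: "indep_sequences M X Y"
    and l: "l \<ge> \<delta> + 1"
  shows "(\<integral>\<omega>. window_Z M \<delta> X Y l \<omega> * window_Z M \<delta> X Y (l + k) \<omega> \<partial>M) =
    (if k = 0 then p else p\<^sup>2) *
      ((2 * real \<delta> + 1)\<^sup>2 * q\<^sup>2 + real (2 * \<delta> + 1 - k) * (q * (1 - q)))
    - ((2 * real \<delta> + 1) * p * q)\<^sup>2"
proof -
  interpret prob_space M by (rule M)
  let ?I = "\<lambda>i. {i - \<delta>..i + \<delta>}"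
  let ?U = "window_W \<delta> X Y l" and ?V = "window_W \<delta> X Y (l + k)"
  let ?m = "(2 * real \<delta> + 1) * p * q"
  have sub: "?I i \<subseteq> {1..}" and card: "real (card (?I i)) = 2 * real \<delta> + 1" if "i \<ge> l" for i
    using l that by auto
  have WU: "?U = (\<lambda>\<omega>. X l \<omega> * (\<Sum>a\<in>?I l. Y a \<omega>))"
    and WV: "?V = (\<lambda>\<omega>. X (l + k) \<omega> * (\<Sum>a\<in>?I (l + k). Y a \<omega>))"
    using l by (auto intro: window_W_eq_sum_interval)
  have U: "integrable M ?U" "integral\<^sup>L M ?U = ?m"
    unfolding WU using expectation_weighted_sum[OF M X p Y q XY, of l "?I l"] sub[of l] card[of l] l
    by (auto simp: mult_ac)
  have V: "integrable M ?V" "integral\<^sup>L M ?V = ?m"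
    unfolding WV using expectation_weighted_sum[OF M X p Y q XY, of "l + k" "?I (l + k)"]
      sub[of "l + k"] card[of "l + k"] l
    by (auto simp: mult_ac)
  have "?I l \<inter> ?I (l + k) = {l + k - \<delta>..l + \<delta>}" by auto
  then have overlap: "card (?I l \<inter> ?I (l + k)) = 2 * \<delta> + 1 - k" using l by simp
  have UV: "integrable M (\<lambda>\<omega>. ?U \<omega> * ?V \<omega>)"
    "(\<integral>\<omega>. ?U \<omega> * ?V \<omega> \<partial>M) = (if k = 0 then p else p\<^sup>2) *
      ((2 * real \<delta> + 1)\<^sup>2 * q\<^sup>2 + real (2 * \<delta> + 1 - k) * (q * (1 - q)))"
  proof -
    have pos: "l \<ge> 1" "l + k \<ge> 1" using l by auto
    note E = expectation_product_of_weighted_sums[OF M X p Y q XY pos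
        finite_atLeastAtMost finite_atLeastAtMost sub[OF order_refl] sub[OF le_add1]]
    show "integrable M (\<lambda>\<omega>. ?U \<omega> * ?V \<omega>)" unfolding WU WV by (rule E(1))
    show "(\<integral>\<omega>. ?U \<omega> * ?V \<omega> \<partial>M) = (if k = 0 then p else p\<^sup>2) *
      ((2 * real \<delta> + 1)\<^sup>2 * q\<^sup>2 + real (2 * \<delta> + 1 - k) * (q * (1 - q)))"
      unfolding WU WV E(2) overlap card[OF order_refl] card[OF le_add1]
      by (simp add: power2_eq_square)
  qed
  have "(\<lambda>\<omega>. window_Z M \<delta> X Y l \<omega> * window_Z M \<delta> X Y (l + k) \<omega>) =
      (\<lambda>\<omega>. ?U \<omega> * ?V \<omega> - ?m * ?U \<omega> - ?m * ?V \<omega> + ?m\<^sup>2)"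
    unfolding window_Z_def U(2) V(2) by (auto simp: algebra_simps power2_eq_square)
  then have "(\<integral>\<omega>. window_Z M \<delta> X Y l \<omega> * window_Z M \<delta> X Y (l + k) \<omega> \<partial>M) =
      (\<integral>\<omega>. ?U \<omega> * ?V \<omega> - ?m * ?U \<omega> - ?m * ?V \<omega> + ?m\<^sup>2 \<partial>M)"
    by simp
  also have "\<dots> = (\<integral>\<omega>. ?U \<omega> * ?V \<omega> \<partial>M) - ?m * integral\<^sup>L M ?U - ?m * integral\<^sup>L M ?V + ?m\<^sup>2"
    using U(1) V(1) UV(1) by (simp add: prob_space)
  also have "\<dots> = (\<integral>\<omega>. ?U \<omega> * ?V \<omega> \<partial>M) - ?m\<^sup>2"
    unfolding U(2) V(2) by (simp add: power2_eq_square)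
  finally show ?thesis unfolding UV(2) .
qed

lemma sum_descending:
  "2 * (\<Sum>k=1..n. real (n - k)) = real n * (real n - 1)"
proof -
  have "(\<Sum>k=1..n. real (n - k)) = (\<Sum>k<n. real k)"
    by (intro sum.reindex_bij_witness[of _ "\<lambda>k. n - k" "\<lambda>k. n - k"]) auto
  also have "2 * \<dots> = real n * (real n - 1)"
    by (induction n) (auto simp: algebra_simps)
  finally show ?thesis .
qed

theorem lemma2p1:
  fixes M :: "'a measure" and X Y :: "nat \<Rightarrow> 'a \<Rightarrow> real"
    and pX pY :: real and \<delta> l :: nat
  assumes "prob_space M"
    and "pX \<in> {0..1}" and "pY \<in> {0..1}"
    and "iid_bernoulli M X pX" and "iid_bernoulli M Y pY"
    and "indep_sequences M X Y"
    and "l \<ge> \<delta> + 1"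
  shows "sigma_sq M \<delta> X Y l =
           prob_space.variance M (window_W \<delta> X Y l) +
           2 * (\<Sum>k=1..2*\<delta>+1. covariance M (window_W \<delta> X Y l) (window_W \<delta> X Y (l + k))) \<and>
         sigma_sq M \<delta> X Y l =
           (2 * real \<delta> + 1) * pX * pY * (1 - pX * pY) +
           2 * real \<delta> * (2 * real \<delta> + 1) * pX * pY * (pY * (1 - pX) + pX * (1 - pY))"
proof
  show "sigma_sq M \<delta> X Y l =
           prob_space.variance M (window_W \<delta> X Y l) +
           2 * (\<Sum>k=1..2*\<delta>+1. covariance M (window_W \<delta> X Y l) (window_W \<delta> X Y (l + k)))"
    by (simp add: sigma_sq_def covariance_def window_Z_def)
next
  let ?n = "2 * real \<delta> + 1"
  note cov = expectation_window_Z_mult[OF assms(1,4,2,5,3,6,7)]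
  have var: "(\<integral>\<omega>. (window_Z M \<delta> X Y l \<omega>)\<^sup>2 \<partial>M) =
      pX * (?n\<^sup>2 * pY\<^sup>2 + ?n * (pY * (1 - pY))) - (?n * pX * pY)\<^sup>2"
    using cov[of 0] by (simp add: power2_eq_square)
  have "2 * (\<Sum>k=1..2*\<delta>+1. \<integral>\<omega>. window_Z M \<delta> X Y l \<omega> * window_Z M \<delta> X Y (l + k) \<omega> \<partial>M) =
      2 * (\<Sum>k=1..2*\<delta>+1. pX\<^sup>2 * (pY * (1 - pY)) * real (2 * \<delta> + 1 - k))"
    unfolding cov
    by (intro arg_cong[where f="(*) 2"] sum.cong refl) (auto simp: power2_eq_square algebra_simps)
  also have "\<dots> = pX\<^sup>2 * (pY * (1 - pY)) * (2 * (\<Sum>k=1..2*\<delta>+1. real (2 * \<delta> + 1 - k)))"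
    by (simp only: sum_distrib_left[symmetric] mult.left_commute)
  also have "\<dots> = pX\<^sup>2 * (pY * (1 - pY)) * (?n * (?n - 1))"
    unfolding sum_descending by simp
  finally show "sigma_sq M \<delta> X Y l =
           (2 * real \<delta> + 1) * pX * pY * (1 - pX * pY) +
           2 * real \<delta> * (2 * real \<delta> + 1) * pX * pY * (pY * (1 - pX) + pX * (1 - pY))"
    unfolding sigma_sq_def var by (simp add: power2_eq_square algebra_simps)
qed

end
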